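(* Let $(X,\delta)$ be a dynamical system with $X$ compact and $\delta=(\delta_1,\dots,\delta_N)$. For $i=1,\dots,N$ let $a_i:X\to\mathbb{R}$ be non-negative continuous functions such that $\sum_{i=1}^N a_i(x)\le 1$ for all $x\in X$. Define the guiding sets $$\Lambda_i=\{x\in X: a_i(x)=0\},\qquad i=1,\dots,N.$$ Assume that there is in $X$ a $\Lambda$-weak attractor $x_0$, and that $x_0\in\{x\in X:\sum_{i=1}^N a_i(x)<1\}$. Then for any $h\in C(X)$ the functional equation $$f(x)-\sum_{i=1}^N a_i(x)f(\delta_i(x))=h(x),\qquad x\in X,$$ has a unique solution $f\in C(X)$.
   Context: A dynamical system $(X,\delta)$ is a metric space $X$ with a finite family $\delta=(\delta_1,\dots,\delta_N)$ of continuous maps $\delta_i:X\to X$. A guided dynamical system is a dynamical system together with closed subsets $\Lambda=(\Lambda_1,\dots,\Lambda_N)$ of $X$ (guiding sets); it is always assumed that $\bigcap_{i=1}^N\Lambda_i=\emptyset$. A $\Lambda$-proper orbit emanating from $x_1$ is a finite or infinite sequence $(x_1,x_2,\dots)$ such that for every $j\ge 2$ there is an index $i$ with $x_{j-1}\notin\Lambda_i$ and $x_j=\delta_i(x_{j-1})$. $\Lambda\text{-}OS(x)$ is the set of all $y$ for which there is a finite $\Lambda$-proper orbit $(x,\dots,y)$ (the one-term orbit $(x)$ is allowed). A point $x_0\in X$ is a $\Lambda$-weak attractor if $x_0\in\bigcap_{x\in X}\overline{\Lambda\text{-}OS(x)}$. $C(X)$ is the space of continuous real-valued functions on $X$. 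*)

theory Defs
  imports "HOL-Analysis.Analysis"
begin

text \<open>The metric space \<open>X\<close> is the carrier of a type of class \<open>metric_space\<close>. Families of length \<open>N\<close>
  are functions on \<open>nat\<close> of which only the values at \<open>{1..N}\<close> matter.\<close>

definition dynamical_system :: "nat \<Rightarrow> (nat \<Rightarrow> 'a::metric_space \<Rightarrow> 'a) \<Rightarrow> bool" where
  "dynamical_system N \<delta> \<longleftrightarrow> (\<forall>i\<in>{1..N}. continuous_on UNIV (\<delta> i))"

text \<open>For \<open>N = 0\<close> the intersection is the whole space, so the last condition forces \<open>N \<ge> 1\<close>.\<close>

definition guided_dynamical_system ::
  "nat \<Rightarrow> (nat \<Rightarrow> 'a::metric_space \<Rightarrow> 'a) \<Rightarrow> (nat \<Rightarrow> 'a set) \<Rightarrow> bool" where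
  "guided_dynamical_system N \<delta> \<Lambda> \<longleftrightarrow>
     dynamical_system N \<delta> \<and> (\<forall>i\<in>{1..N}. closed (\<Lambda> i)) \<and> (\<Inter>i\<in>{1..N}. \<Lambda> i) = {}"

text \<open>Only finite orbits enter the definition of a weak attractor, so orbits are
  non-empty lists.\<close>

definition proper_orbit ::
  "nat \<Rightarrow> (nat \<Rightarrow> 'a \<Rightarrow> 'a) \<Rightarrow> (nat \<Rightarrow> 'a set) \<Rightarrow> 'a list \<Rightarrow> bool" where
  "proper_orbit N \<delta> \<Lambda> xs \<longleftrightarrow> xs \<noteq> [] \<and>
     (\<forall>j. Suc j < length xs \<longrightarrow> (\<exists>i\<in>{1..N}. xs ! j \<notin> \<Lambda> i \<and> xs ! Suc j = \<delta> i (xs ! j)))"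

definition orbit_set ::
  "nat \<Rightarrow> (nat \<Rightarrow> 'a \<Rightarrow> 'a) \<Rightarrow> (nat \<Rightarrow> 'a set) \<Rightarrow> 'a \<Rightarrow> 'a set" where
  "orbit_set N \<delta> \<Lambda> x = {y. \<exists>xs. proper_orbit N \<delta> \<Lambda> xs \<and> hd xs = x \<and> last xs = y}"

definition weak_attractor ::
  "nat \<Rightarrow> (nat \<Rightarrow> 'a::metric_space \<Rightarrow> 'a) \<Rightarrow> (nat \<Rightarrow> 'a set) \<Rightarrow> 'a \<Rightarrow> bool" where
  "weak_attractor N \<delta> \<Lambda> x0 \<longleftrightarrow> x0 \<in> (\<Inter>x. closure (orbit_set N \<delta> \<Lambda> x))"

end

theory Submission imports Defs begin

text \<open>Let \<open>T f x = (\<Sum>i. a\<^sub>i x * f (\<delta>\<^sub>i x))\<close>, a positive operator with \<open>T 1 \<le> 1\<close>. The functions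
  \<open>T\<^sup>n 1\<close> decrease, and \<open>T 1 < 1\<close> on a neighbourhood of the weak attractor. From each point a proper
  orbit enters this neighbourhood, and the strict inequality travels back along the orbit because
  its steps have positive weight. By compactness some \<open>T\<^sup>n 1\<close> is bounded by a constant \<open>q < 1\<close>, so
  the Neumann series of \<open>h\<close> converges uniformly, and it gives the only solution.\<close>

definition transfer ::
  "nat \<Rightarrow> (nat \<Rightarrow> 'a \<Rightarrow> 'a) \<Rightarrow> (nat \<Rightarrow> 'a \<Rightarrow> real) \<Rightarrow> ('a \<Rightarrow> real) \<Rightarrow> 'a \<Rightarrow> real" where
  "transfer N \<delta> a f x = (\<Sum>i=1..N. a i x * f (\<delta> i x))"

text \<open>With \<open>r\<close> the \<open>n\<close>-th root of \<open>q\<close>, the inequality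
  \<open>r ^ (k mod n) \<ge> r ^ n = q\<close> bounds the terms, which are constant on blocks of
  length \<open>n\<close>, by the geometric sequence \<open>r ^ k / q\<close>.\<close>

lemma summable_power_div:
  fixes q :: real
  assumes "0 < q" "q < 1" "0 < n"
  shows "summable (\<lambda>k. q ^ (k div n))"
proof (rule summable_comparison_test')
  define r where "r = root n q"
  have r: "0 < r" "r < 1" "r ^ n = q"
    using assms by (auto simp: r_def real_root_pow_pos)
  show "summable (\<lambda>k. r ^ k / q)"
    using r by (intro summable_divide summable_geometric) auto
  show "norm (q ^ (k div n)) \<le> r ^ k / q" if "0 \<le> k" for k
  proof -
    have "q * q ^ (k div n) \<le> r ^ (k mod n) * q ^ (k div n)"
      using assms r power_decreasing[of "k mod n" n r]
      by (intro mult_right_mono) (auto simp: less_imp_le)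
    also have "\<dots> = r ^ (k mod n + n * (k div n))"
      by (simp only: power_add power_mult r)
    also have "\<dots> = r ^ k" by simp
    finally show ?thesis using assms by (simp add: field_simps)
  qed
qed

locale substochastic =
  fixes N :: nat
    and \<delta> :: "nat \<Rightarrow> 'a::metric_space \<Rightarrow> 'a"
    and a :: "nat \<Rightarrow> 'a \<Rightarrow> real"
  assumes weight_cont: "i \<in> {1..N} \<Longrightarrow> continuous_on UNIV (a i)"
    and weight_nonneg: "i \<in> {1..N} \<Longrightarrow> 0 \<le> a i x"
    and weight_sum: "(\<Sum>i=1..N. a i x) \<le> 1"
    and map_cont: "i \<in> {1..N} \<Longrightarrow> continuous_on UNIV (\<delta> i)"
begin

abbreviation T :: "('a \<Rightarrow> real) \<Rightarrow> 'a \<Rightarrow> real" where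
  "T \<equiv> transfer N \<delta> a"

text \<open>A survival probability: let a walker at \<open>x\<close> move to
  \<open>\<delta> i x\<close> with probability \<open>a i x\<close> and die with the remaining
  probability; \<open>mass n x\<close> is the chance of surviving \<open>n\<close> steps from
  \<open>x\<close>.\<close>

abbreviation mass :: "nat \<Rightarrow> 'a \<Rightarrow> real" where
  "mass n \<equiv> (T ^^ n) (\<lambda>_. 1)"

lemma continuous_transfer:
  assumes "continuous_on UNIV f"
  shows "continuous_on UNIV (T f)"
  unfolding transfer_def
  by (intro continuous_intros weight_cont
        continuous_on_compose2[OF assms map_cont]) auto

lemma continuous_transfer_power:
  "continuous_on UNIV f \<Longrightarrow> continuous_on UNIV ((T ^^ n) f)"
  by (induction n) (auto intro: continuous_transfer)

lemma transfer_mono: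
  assumes "\<And>x. f x \<le> g x"
  shows "T f x \<le> T g x"
  unfolding transfer_def by (intro sum_mono mult_left_mono assms weight_nonneg)

text \<open>Positivity of \<open>T\<close> carries the bound by a constant through each iterate.
  Hence estimates on \<open>mass n\<close> control \<open>T ^^ n\<close> on all bounded
  functions.\<close>

lemma transfer_power_bound:
  assumes "\<And>x. \<bar>f x\<bar> \<le> C"
  shows "\<bar>(T ^^ n) f x\<bar> \<le> C * mass n x"
proof (induction n arbitrary: x)
  case 0
  then show ?case using assms by simp
next
  case (Suc n)
  have "\<bar>T ((T ^^ n) f) x\<bar> \<le> (\<Sum>i=1..N. \<bar>a i x * (T ^^ n) f (\<delta> i x)\<bar>)"
    unfolding transfer_def by (rule sum_abs)
  also have "\<dots> \<le> (\<Sum>i=1..N. a i x * (C * mass n (\<delta> i x)))"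
    using Suc.IH weight_nonneg by (intro sum_mono) (auto simp: abs_mult intro!: mult_mono)
  also have "\<dots> = C * mass (Suc n) x"
    by (simp add: transfer_def sum_distrib_left mult_ac)
  finally show ?case by simp
qed

lemma mass_nonneg: "0 \<le> mass n x"
  using transfer_power_bound[of "\<lambda>_. 1" 1 n x] by simp

lemma mass_antimono: "m \<le> n \<Longrightarrow> mass n x \<le> mass m x"
proof -
  have "mass (Suc n) x \<le> mass n x" for n x
  proof (induction n arbitrary: x)
    case 0
    then show ?case using weight_sum by (simp add: transfer_def)
  next
    case (Suc n)
    then show ?case by (simp add: transfer_mono)
  qed
  then show "m \<le> n \<Longrightarrow> mass n x \<le> mass m x"
    by (rule lift_Suc_antimono_le[of "\<lambda>n. mass n x"])
qed

lemma mass_le_1: "mass n x \<le> 1"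
  using mass_antimono[of 0 n x] by simp

text \<open>Every summand is at most \<open>a j x\<close> because masses never exceed 1, and the
  \<open>i\<close>-th is strictly smaller because its weight is positive. So one deficient successor
  is enough.\<close>

lemma mass_less_1_step:
  assumes i: "i \<in> {1..N}" and "a i x \<noteq> 0" and "mass n (\<delta> i x) < 1"
  shows "mass (Suc n) x < 1"
proof -
  have "mass (Suc n) x = (\<Sum>j=1..N. a j x * mass n (\<delta> j x))"
    by (simp add: transfer_def)
  also have "\<dots> < (\<Sum>j=1..N. a j x)"
  proof (rule sum_strict_mono_ex1)
    show "\<forall>j\<in>{1..N}. a j x * mass n (\<delta> j x) \<le> a j x"
      using weight_nonneg mass_le_1 by (auto intro: mult_left_le)
    have "a i x > 0" using assms weight_nonneg[OF i, of x] by simp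
    then show "\<exists>j\<in>{1..N}. a j x * mass n (\<delta> j x) < a j x"
      using assms by (intro bexI[OF _ i]) simp
  qed simp
  also have "\<dots> \<le> 1" by (rule weight_sum)
  finally show ?thesis .
qed

lemma mass_less_1_orbit:
  assumes "y \<in> orbit_set N \<delta> (\<lambda>i. {x. a i x = 0}) x" and "mass m y < 1"
  shows "\<exists>n. mass n x < 1"
proof -
  obtain xs where "proper_orbit N \<delta> (\<lambda>i. {x. a i x = 0}) xs" "hd xs = x" "last xs = y"
    using assms(1) by (auto simp: orbit_set_def)
  then show ?thesis
  proof (induction xs arbitrary: x)
    case Nil
    then show ?case by (simp add: proper_orbit_def)
  next
    case (Cons z zs)
    show ?case
    proof (cases zs)
      case Nil
      then show ?thesis using Cons.prems assms(2) by auto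
    next
      case (Cons w ws)
      have step: "\<exists>i\<in>{1..N}. a i ((z # zs) ! j) \<noteq> 0 \<and> (z # zs) ! Suc j = \<delta> i ((z # zs) ! j)"
        if "Suc j < length (z # zs)" for j
        using Cons.prems(1) that unfolding proper_orbit_def by blast
      \<comment> \<open>Index \<open>j\<close> of the tail is index \<open>Suc j\<close> of the
        whole list; index 0 is kept for the step from \<open>x\<close> to \<open>w\<close>, which
        pulls the inequality back.\<close>
      have "proper_orbit N \<delta> (\<lambda>i. {x. a i x = 0}) zs"
        unfolding proper_orbit_def using step[of "Suc _"] Cons by auto
      then obtain n where "mass n w < 1"
        using Cons.IH[of w] Cons.prems Cons by auto
      moreover obtain i where "i \<in> {1..N}" "a i x \<noteq> 0" "w = \<delta> i x"
        using step[of 0] Cons Cons.prems by auto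
      ultimately show ?thesis using mass_less_1_step by blast
    qed
  qed
qed

text \<open>Since \<open>mass 1\<close> is the sum of the weights, \<open>mass 1 < 1\<close> defines
  an open neighbourhood of \<open>x0\<close>. It meets every orbit set, as \<open>x0\<close> lies in
  the closure of each.\<close>

lemma mass_less_1_pointwise:
  assumes "weak_attractor N \<delta> (\<lambda>i. {x. a i x = 0}) x0" and "(\<Sum>i=1..N. a i x0) < 1"
  shows "\<exists>n. mass n x < 1"
proof -
  have "open {y. mass 1 y < 1}"
    by (intro open_Collect_less continuous_transfer_power continuous_on_const)
  moreover have "x0 \<in> {y. mass 1 y < 1}"
    using assms(2) by (simp add: transfer_def)
  moreover have "x0 \<in> closure (orbit_set N \<delta> (\<lambda>i. {x. a i x = 0}) x)"
    using assms(1) by (auto simp: weak_attractor_def)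
  ultimately obtain y where "y \<in> orbit_set N \<delta> (\<lambda>i. {x. a i x = 0}) x" "mass 1 y < 1"
    by (auto simp: closure_iff_nhds_not_empty)
  then show ?thesis by (rule mass_less_1_orbit)
qed

lemma mass_uniform_bound:
  assumes "compact (UNIV :: 'a set)" and "\<And>x. \<exists>n. mass n x < 1"
  shows "\<exists>n>0. \<exists>q. 0 < q \<and> q < 1 \<and> (\<forall>x. mass n x \<le> q)"
proof -
  have cont: "continuous_on UNIV (mass n)" for n
    by (intro continuous_transfer_power continuous_on_const)
  have "open {x. mass n x < 1}" for n
    by (intro open_Collect_less cont continuous_on_const)
  moreover have "UNIV \<subseteq> (\<Union>n. {x. mass n x < 1})"
    using assms(2) by blast
  ultimately obtain F where F: "finite F" "UNIV \<subseteq> (\<Union>n\<in>F. {x. mass n x < 1})"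
    using compactE_image[OF assms(1), of UNIV "\<lambda>n. {x. mass n x < 1}"] by auto
  \<comment> \<open>Masses decrease in the index, so any index above all of \<open>F\<close> serves
    every point at once; \<open>Suc\<close> also makes it positive, as the later division by
    \<open>n\<close> requires.\<close>
  define n where "n = Suc (Max F)"
  have less: "mass n x < 1" for x
  proof -
    obtain m where "m \<in> F" "mass m x < 1" using F(2) by blast
    moreover from this have "m \<le> n"
      using F(1) by (auto simp: n_def intro: le_SucI)
    ultimately show ?thesis using mass_antimono[of m n x] by linarith
  qed
  obtain y where y: "\<And>x. mass n x \<le> mass n y"
    using continuous_attains_sup[OF assms(1) _ cont] by blast
  \<comment> \<open>The maximum is attained at \<open>y\<close>, hence is below 1. Taking the larger
    of it and 1/2 keeps the ratio positive even if \<open>mass n\<close> vanishes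
    everywhere.\<close>
  have "0 < max (1/2) (mass n y) \<and> max (1/2) (mass n y) < 1
      \<and> (\<forall>x. mass n x \<le> max (1/2) (mass n y))"
    using y less[of y] by (auto intro: max.coboundedI2)
  then show ?thesis unfolding n_def by blast
qed

text \<open>Each further block of \<open>n\<close> applications of \<open>T\<close> contributes a
  factor \<open>q\<close>, and rounding \<open>k\<close> down to a multiple of \<open>n\<close> can
  only increase the mass.\<close>

lemma mass_geometric:
  assumes "\<And>x. mass n x \<le> q" and "0 \<le> q"
  shows "mass k x \<le> q ^ (k div n)"
proof -
  have "mass (n * j) x \<le> q ^ j" for j
  proof (induction j arbitrary: x)
    case 0
    then show ?case by simp
  next
    case (Suc j)
    have "mass (n * Suc j) x = (T ^^ n) (mass (n * j)) x"
      by (simp add: funpow_add)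
    also have "\<dots> \<le> q ^ j * mass n x"
      using transfer_power_bound[of "mass (n * j)" "q ^ j" n x] Suc.IH mass_nonneg by force
    also have "\<dots> \<le> q ^ j * q"
      using assms by (intro mult_left_mono) auto
    finally show ?case by (simp add: mult.commute)
  qed
  from this[of "k div n"] show ?thesis
    using mass_antimono[of "n * (k div n)" k x] by force
qed

lemma exists_unique_solution:
  assumes compact: "compact (UNIV :: 'a set)"
    and attained: "\<And>x. \<exists>n. mass n x < 1"
    and h: "continuous_on UNIV h"
  shows "\<exists>!f. continuous_on UNIV f \<and> (\<forall>x. f x - T f x = h x)"
proof -
  obtain n q where nq: "0 < n" "0 < q" "q < 1" "\<And>x. mass n x \<le> q"
    using mass_uniform_bound[OF compact attained] by blast
  \<comment> \<open>Stated for arbitrary continuous \<open>g\<close> because it is used twice: for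
    \<open>h\<close> to sum the series, and for the difference of two solutions to prove
    uniqueness.\<close>
  have bounded: "\<exists>C. \<forall>k x. \<bar>(T ^^ k) g x\<bar> \<le> C * q ^ (k div n)"
    if g: "continuous_on UNIV g" for g
  proof -
    have "bounded (range g)"
      using compact_continuous_image[OF g compact] by (rule compact_imp_bounded)
    then obtain C where C: "C > 0" "\<And>x. \<bar>g x\<bar> \<le> C"
      by (auto simp: bounded_pos)
    have "\<bar>(T ^^ k) g x\<bar> \<le> C * q ^ (k div n)" for k x
    proof -
      have "C * mass k x \<le> C * q ^ (k div n)"
        using C(1) nq by (intro mult_left_mono mass_geometric) auto
      then show ?thesis using transfer_power_bound[of g C k x, OF C(2)] by linarith
    qed
    then show ?thesis by blast
  qed
  have summable_q: "summable (\<lambda>k. C * q ^ (k div n))" for C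
    using nq by (intro summable_mult summable_power_div)
  obtain C where C: "\<And>k x. \<bar>(T ^^ k) h x\<bar> \<le> C * q ^ (k div n)"
    using bounded[OF h] by blast
  define f where "f x = (\<Sum>k. (T ^^ k) h x)" for x
  have summable: "summable (\<lambda>k. (T ^^ k) h x)" for x
    by (rule summable_comparison_test'[OF summable_q[of C], of 0]) (use C in auto)
  have "uniform_limit UNIV (\<lambda>m x. \<Sum>k<m. (T ^^ k) h x) f sequentially"
    unfolding f_def by (rule Weierstrass_m_test[OF _ summable_q[of C]]) (use C in auto)
  then have cont: "continuous_on UNIV f"
    by (rule uniform_limit_theorem[rotated])
      (auto intro!: always_eventually continuous_on_sum continuous_transfer_power h)
  have solves: "f x - T f x = h x" for x
  proof -
    \<comment> \<open>\<open>T\<close> is a finite sum, so it can be applied termwise; this shifts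
      the series by one index and loses exactly its head \<open>h x\<close>.\<close>
    have "T f x = (\<Sum>i=1..N. \<Sum>k. a i x * (T ^^ k) h (\<delta> i x))"
      unfolding transfer_def[of _ _ _ f] f_def by (simp add: suminf_mult summable)
    also have "\<dots> = (\<Sum>k. \<Sum>i=1..N. a i x * (T ^^ k) h (\<delta> i x))"
      by (rule suminf_sum[symmetric]) (intro summable_mult summable)
    also have "\<dots> = (\<Sum>k. (T ^^ Suc k) h x)"
      by (simp add: transfer_def)
    also have "\<dots> = f x - h x"
      using suminf_split_head[OF summable[of x]] by (simp add: f_def)
    finally show ?thesis by simp
  qed
  have unique: "g = f" if g: "continuous_on UNIV g" "\<And>x. g x - T g x = h x" for g
  proof
    fix x
    \<comment> \<open>The difference of two solutions is fixed by \<open>T\<close>, hence by all its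
      powers, so it is bounded by the null sequence \<open>D * q ^ (k div n)\<close>.\<close>
    define d where "d = (\<lambda>x. g x - f x)"
    have "T d x = T g x - T f x" for x
      by (simp add: d_def transfer_def right_diff_distrib sum_subtractf)
    then have "T d = d"
      using g(2) solves by (auto simp: d_def fun_eq_iff) (smt (verit))
    then have fixed: "(T ^^ k) d = d" for k
      by (induction k) auto
    have "continuous_on UNIV d"
      unfolding d_def by (intro continuous_on_diff g cont)
    then obtain D where D: "\<And>k x. \<bar>(T ^^ k) d x\<bar> \<le> D * q ^ (k div n)"
      using bounded by blast
    have "(\<lambda>k. D * q ^ (k div n)) \<longlonglongrightarrow> 0"
      by (rule summable_LIMSEQ_zero[OF summable_q])
    then have "\<bar>d x\<bar> \<le> 0"
      by (rule LIMSEQ_le_const) (use D[of _ x] fixed in auto)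
    then show "g x = f x" by (simp add: d_def)
  qed
  show ?thesis
    using cont solves unique by blast
qed

end

theorem theorem2p2p1:
  fixes N :: nat
    and \<delta> :: "nat \<Rightarrow> 'a::metric_space \<Rightarrow> 'a"
    and a :: "nat \<Rightarrow> 'a \<Rightarrow> real"
    and \<Lambda> :: "nat \<Rightarrow> 'a set"
    and x0 :: 'a
    and h :: "'a \<Rightarrow> real"
  assumes "compact (UNIV :: 'a set)"
    and "\<And>i. i \<in> {1..N} \<Longrightarrow> continuous_on UNIV (a i)"
    and "\<And>i x. i \<in> {1..N} \<Longrightarrow> a i x \<ge> 0"
    and "\<And>x. (\<Sum>i=1..N. a i x) \<le> 1"
    and "\<And>i. i \<in> {1..N} \<Longrightarrow> \<Lambda> i = {x. a i x = 0}"
    and "guided_dynamical_system N \<delta> \<Lambda>"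
    and "weak_attractor N \<delta> \<Lambda> x0"
    and "x0 \<in> {x. (\<Sum>i=1..N. a i x) < 1}"
    and "continuous_on UNIV h"
  shows "\<exists>!f :: 'a \<Rightarrow> real. continuous_on UNIV f \<and>
           (\<forall>x. f x - (\<Sum>i=1..N. a i x * f (\<delta> i x)) = h x)"
proof -
  interpret substochastic N \<delta> a
    using assms(2-4,6)
    by unfold_locales (auto simp: guided_dynamical_system_def dynamical_system_def)
  \<comment> \<open>\<open>\<Lambda>\<close> is known only at the indices \<open>1..N\<close>, so
    the two families may differ as functions; proper orbits consult only those indices.\<close>
  have "proper_orbit N \<delta> \<Lambda> = proper_orbit N \<delta> (\<lambda>i. {x. a i x = 0})"
    unfolding proper_orbit_def using assms(5) by (intro ext) auto
  then have "weak_attractor N \<delta> (\<lambda>i. {x. a i x = 0}) x0"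
    using assms(7) by (simp add: weak_attractor_def orbit_set_def)
  then have "\<exists>n. mass n x < 1" for x
    using assms(8) by (intro mass_less_1_pointwise) auto
  from exists_unique_solution[OF assms(1) this assms(9)] show ?thesis
    by (simp add: transfer_def)
qed

end
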